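(* Let $w$ be an overlap-free binary word, and suppose $w = S_1 S_2 \cdots S_k$ where each $S_i$ is a square. Then $k + L(w) + R(w) \leq 9$.
   Context: A square is a word of the form $xx$ with $x$ a nonempty word. An overlap is a word of the form $axaxa$ where $a$ is a single letter and $x$ a possibly empty word; a word is overlap-free if none of its factors (contiguous subwords) is an overlap. For a binary word $w$, $L(w) = 1$ if there exists $a \in \{0,1\}$ such that $aw$ is overlap-free and $L(w) = 0$ otherwise; $R(w) = 1$ if there exists $a \in \{0,1\}$ such that $wa$ is overlap-free and $R(w) = 0$ otherwise. *)

theory Defs
  imports Main "HOL-Library.Sublist"
begin

text \<open>Binary words are lists over the two-letter type \<^typ>\<open>bool\<close> (\<^term>\<open>False\<close> for the
  letter 0, \<^term>\<open>True\<close> for the letter 1); factors are the contiguous sublists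
  \<^const>\<open>sublist\<close>.\<close>

definition is_square :: "'a list \<Rightarrow> bool" where
  "is_square u \<longleftrightarrow> (\<exists>x. x \<noteq> [] \<and> u = x @ x)"

definition is_overlap :: "'a list \<Rightarrow> bool" where
  "is_overlap u \<longleftrightarrow> (\<exists>a x. u = [a] @ x @ [a] @ x @ [a])"

definition overlap_free :: "'a list \<Rightarrow> bool" where
  "overlap_free w \<longleftrightarrow> (\<forall>u. sublist u w \<longrightarrow> \<not> is_overlap u)"

definition left_ext :: "bool list \<Rightarrow> nat" where
  "left_ext w = (if \<exists>a. overlap_free ([a] @ w) then 1 else 0)"

definition right_ext :: "bool list \<Rightarrow> nat" where
  "right_ext w = (if \<exists>a. overlap_free (w @ [a]) then 1 else 0)"

end

theory Submission
  imports Defs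
begin

text \<open>If \<open>w\<close> has no left extension, then deleting \<open>S\<^sub>1\<close> leaves a left extendable word, and
  symmetrically on the right; so it is enough to show \<open>k \<le> 7\<close> when \<open>cw\<close> and \<open>wd\<close> are both
  overlap-free. Such a \<open>w\<close> of even length has no factor \<open>aaa\<close>, \<open>ababa\<close> or \<open>aabaa\<close>, hence all its
  factors \<open>aa\<close> start at positions of the same parity. If these positions, counted from 0, are odd,
  \<open>w\<close> is an image under the Thue--Morse morphism; the \<open>S\<^sub>i\<close>, which start at even positions, are
  then images of squares, and one descends to the preimage, which is again extendable on both sides.
  If they are even, it is \<open>awb\<close> that is an image for some letters \<open>a\<close> and \<open>b\<close>, and its blocks
  straddle the boundaries of the \<open>S\<^sub>i\<close>. If \<open>k \<ge> 2\<close>, then every \<open>S\<^sub>i\<close> is one of 00, 11, 010010,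
  101101, and a finite search shows that no overlap-free word consists of a letter followed by eight
  of these.\<close>

lemma overlap_free_sublist: "overlap_free w \<Longrightarrow> sublist u w \<Longrightarrow> overlap_free u"
  unfolding overlap_free_def using sublist_order.order.trans by blast

lemma overlap_free_appendD:
  assumes "overlap_free (u @ v)"
  shows "overlap_free u" and "overlap_free v"
  using assms by (blast intro: overlap_free_sublist)+

lemma overlap_free_ConsD: "overlap_free (a # w) \<Longrightarrow> overlap_free w"
  using overlap_free_appendD(2)[of "[a]"] by simp

lemma is_overlap_rev: "is_overlap u \<Longrightarrow> is_overlap (rev u)"
  unfolding is_overlap_def by (elim exE) (simp, metis)

lemma overlap_free_rev: "overlap_free (rev w) \<longleftrightarrow> overlap_free (w :: 'a list)"
proof -
  have "overlap_free (rev v)" if "overlap_free v" for v :: "'a list"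
    using that unfolding overlap_free_def sublist_rev_right by (blast dest: is_overlap_rev)
  from this[of w] this[of "rev w"] show ?thesis by auto
qed

lemma not_overlap_free_overlap: "\<not> overlap_free (p @ a # x @ a # x @ a # q)"
proof -
  have "is_overlap (a # x @ a # x @ [a])"
    unfolding is_overlap_def by auto
  moreover have "sublist (a # x @ a # x @ [a]) (p @ a # x @ a # x @ a # q)"
    using sublist_appendI[of "a # x @ a # x @ [a]" p q] by simp
  ultimately show ?thesis unfolding overlap_free_def by blast
qed

lemma not_overlap_free_square_hd:
  assumes "x \<noteq> []"
  shows "\<not> overlap_free (p @ x @ x @ hd x # q)"
  using not_overlap_free_overlap[of p "hd x" "tl x" q] assms by (cases x) simp_all

lemma not_overlap_free_last_square:
  assumes "x \<noteq> []"
  shows "\<not> overlap_free (p @ last x # x @ x @ q)"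
  using not_overlap_free_overlap[of p "last x" "butlast x" q] assms
  by (cases x rule: rev_cases) simp_all

lemma overlap_free_Nil [code]: "overlap_free [] \<longleftrightarrow> True"
  by (simp add: overlap_free_def is_overlap_def)

lemma overlap_free_Cons [code]:
  "overlap_free (a # w) \<longleftrightarrow>
    overlap_free w \<and> (\<forall>x \<in> set (prefixes w). \<not> prefix (x @ a # x @ [a]) w)"
proof -
  have "overlap_free (a # w) \<longleftrightarrow> overlap_free w \<and> \<not> (\<exists>u. prefix u (a # w) \<and> is_overlap u)"
    unfolding overlap_free_def sublist_Cons_right by blast
  also have "(\<exists>u. prefix u (a # w) \<and> is_overlap u)
      \<longleftrightarrow> (\<exists>b x. prefix ([b] @ x @ [b] @ x @ [b]) (a # w))"
    unfolding is_overlap_def by blast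
  also have "\<dots> \<longleftrightarrow> (\<exists>x. prefix (x @ a # x @ [a]) w)" by auto
  also have "\<dots> \<longleftrightarrow> (\<exists>x \<in> set (prefixes w). prefix (x @ a # x @ [a]) w)"
    by (metis append_prefixD in_set_prefixes)
  finally show ?thesis by simp
qed

lemma overlap_free_aabaa_at_end:
  fixes a :: bool
  assumes "overlap_free (p @ [a, a, \<not> a, a, a] @ q)"
  shows "p = [] \<or> q = []"
proof (rule ccontr)
  assume "\<not> ?thesis"
  then obtain p' c d q' where p: "p = p' @ [c]" and q: "q = d # q'"
    by (metis list.exhaust rev_exhaust)
  have "c \<noteq> a"
  proof
    assume "c = a"
    then show False
      using not_overlap_free_overlap[of p' a "[]" "(\<not> a) # a # a # q"] assms p by simp
  qed
  moreover have "d \<noteq> a"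
  proof
    assume "d = a"
    then show False
      using not_overlap_free_overlap[of "p @ [a, a, \<not> a]" a "[]" q'] assms q by simp
  qed
  ultimately have "c = (\<not> a)" "d = (\<not> a)" by simp_all
  then show False
    using not_overlap_free_overlap[of p' "\<not> a" "[a, a]" q'] assms p q by simp
qed

fun thue_morse :: "bool list \<Rightarrow> bool list" where
  "thue_morse [] = []"
| "thue_morse (a # w) = a # (\<not> a) # thue_morse w"

lemma thue_morse_append [simp]: "thue_morse (u @ v) = thue_morse u @ thue_morse v"
  by (induction u) auto

lemma length_thue_morse [simp]: "length (thue_morse w) = 2 * length w"
  by (induction w) auto

lemma inj_thue_morse: "inj thue_morse"
proof
  fix u v assume "thue_morse u = thue_morse v"
  then show "u = v"
  proof (induction u arbitrary: v)
    case Nil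
    then show ?case by (cases v) auto
  next
    case (Cons a u)
    then show ?case by (cases v) auto
  qed
qed

lemma count_list_thue_morse: "count_list (thue_morse w) a = length w"
  by (induction w) auto

lemma thue_morse_eq_appendE:
  assumes "thue_morse w = p @ q" and "even (length p)"
  obtains u v where "w = u @ v" "thue_morse u = p" "thue_morse v = q"
proof
  let ?n = "length p div 2"
  have "thue_morse (take ?n w) @ thue_morse (drop ?n w) = p @ q"
    using assms(1) by (metis append_take_drop_id thue_morse_append)
  moreover have "length p \<le> 2 * length w"
    using arg_cong[OF assms(1), of length] by simp
  then have "length (thue_morse (take ?n w)) = length p"
    using assms(2) by auto
  ultimately show "thue_morse (take ?n w) = p" "thue_morse (drop ?n w) = q"
    by (metis append_eq_append_conv)+
qed simp

lemma thue_morse_eq_squareE: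
  assumes "thue_morse w = x @ x"
  obtains y where "x = thue_morse y" "w = y @ y"
proof -
  \<comment> \<open>Each block has exactly one letter 1, so the number of blocks is the number of 1's in \<open>xx\<close>.\<close>
  have "length w = 2 * count_list x True"
    using count_list_thue_morse[of w True] assms by simp
  moreover have "length w = length x"
    using arg_cong[OF assms, of length] by simp
  ultimately have "even (length x)" by simp
  then obtain u v where "w = u @ v" "thue_morse u = x" "thue_morse v = x"
    using thue_morse_eq_appendE[OF assms] by blast
  moreover from this have "u = v" by (simp add: injD[OF inj_thue_morse])
  ultimately show thesis using that[of v] by simp
qed

lemma sublist_thue_morse: "sublist u w \<Longrightarrow> sublist (thue_morse u) (thue_morse w)"
  unfolding sublist_def by (metis thue_morse_append)

lemma is_overlap_thue_morse:
  assumes "is_overlap u"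
  shows "is_overlap (tl (thue_morse u))" and "is_overlap (butlast (thue_morse u))"
proof -
  obtain a x where u: "u = [a] @ x @ [a] @ x @ [a]"
    using assms unfolding is_overlap_def by blast
  let ?y = "thue_morse x @ [a]" and ?z = "(\<not> a) # thue_morse x"
  have "tl (thue_morse u) = [\<not> a] @ ?y @ [\<not> a] @ ?y @ [\<not> a]" by (simp add: u)
  then show "is_overlap (tl (thue_morse u))" unfolding is_overlap_def by blast
  have "butlast (thue_morse u) = [a] @ ?z @ [a] @ ?z @ [a]" by (simp add: u butlast_append)
  then show "is_overlap (butlast (thue_morse u))" unfolding is_overlap_def by blast
qed

lemma sublist_tl_mono: "sublist u w \<Longrightarrow> sublist (tl u) (tl w)"
proof (cases u)
  case (Cons a v)
  assume "sublist u w"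
  then obtain p q where w: "w = p @ u @ q" unfolding sublist_def by blast
  show ?thesis
    using sublist_appendI[of v "tl p @ [a]" q] by (cases p) (simp_all add: w Cons)
qed simp

lemma sublist_butlast_mono: "sublist u w \<Longrightarrow> sublist (butlast u) (butlast w)"
  by (metis butlast_rev rev_rev_ident sublist_rev sublist_tl_mono)

lemma overlap_free_thue_morseD:
  assumes "overlap_free (tl (thue_morse w)) \<or> overlap_free (butlast (thue_morse w))"
  shows "overlap_free w"
  unfolding overlap_free_def
proof (intro allI impI notI)
  fix u assume "sublist u w" "is_overlap u"
  then have "sublist (tl (thue_morse u)) (tl (thue_morse w))"
    "sublist (butlast (thue_morse u)) (butlast (thue_morse w))"
    by (simp_all add: sublist_thue_morse sublist_tl_mono sublist_butlast_mono)
  with is_overlap_thue_morse[OF \<open>is_overlap u\<close>] assms show False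
    unfolding overlap_free_def by blast
qed

fun block_aligned :: "'a list \<Rightarrow> bool" where
  "block_aligned (a # b # w) \<longleftrightarrow> a \<noteq> b \<and> block_aligned w"
| "block_aligned _ \<longleftrightarrow> True"

lemma block_aligned_completion:
  "block_aligned w \<Longrightarrow> \<exists>v. w @ v \<in> range thue_morse \<and> length v = length w mod 2"
proof (induction w rule: induct_list012)
  case 1
  have "[] @ [] = thue_morse []" by simp
  then show ?case by fastforce
next
  case (2 a)
  have "[a] @ [\<not> a] = thue_morse [a]" by simp
  then show ?case by fastforce
next
  case (3 a b w)
  then obtain v y where "w @ v = thue_morse y" "length v = length w mod 2"
    by auto
  moreover have "b = (\<not> a)" using 3(3) by auto
  ultimately have "(a # b # w) @ v = thue_morse (a # y)" "length v = length (a # b # w) mod 2"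
    by simp_all
  then show ?case by blast
qed

lemma block_aligned_after_double:
  fixes a :: bool
  assumes "overlap_free (a # a # w)" and "\<forall>b. \<not> sublist [b, b, \<not> b, b, b] (a # a # w)"
  shows "block_aligned (a # w)"
  using assms
proof (induction "length w" arbitrary: a w rule: less_induct)
  case less
  let ?b = "\<not> a"
  have block_aligned_suffix: "block_aligned (?b # v)" if "suffix (?b # ?b # v) w" for v
  proof (rule less.hyps)
    have "sublist (?b # ?b # v) (a # a # w)"
      using that by (simp add: sublist_Cons_right suffix_imp_sublist)
    then show "overlap_free (?b # ?b # v)" "\<forall>b. \<not> sublist [b, b, \<not> b, b, b] (?b # ?b # v)"
      using less.prems overlap_free_sublist sublist_order.order.trans by blast+
    show "length v < length w" using suffix_length_le[OF that] by simp
  qed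
  consider "w \<in> {[], [?b], [?b, a], [?b, a, ?b]}"
    | v where "w = a # v" | v where "w = ?b # ?b # v" | v where "w = ?b # a # a # v"
    | v where "w = ?b # a # ?b # a # v" | v where "w = ?b # a # ?b # ?b # v"
    by (cases w; cases "tl w"; cases "tl (tl w)"; cases "tl (tl (tl w))") auto
  then show ?case
  proof cases
    case (2 v)
    then show ?thesis using less.prems(1) not_overlap_free_overlap[of "[]" a "[]" v] by simp
  next
    case (3 v)
    then show ?thesis using block_aligned_suffix[of v] by simp
  next
    case (4 v)
    then show ?thesis using less.prems(2) by (auto simp: sublist_Cons_right)
  next
    case (5 v)
    then show ?thesis using less.prems(1) not_overlap_free_overlap[of "[a]" a "[?b]" v] by simp
  next
    case (6 v)
    then show ?thesis using block_aligned_suffix[of v] by (simp add: suffix_Cons)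
  qed auto
qed

lemma overlap_free_block_aligned:
  fixes w :: "bool list"
  assumes "overlap_free w" and "\<forall>a. \<not> sublist [a, a, \<not> a, a, a] w"
  shows "block_aligned w \<or> block_aligned (tl w)"
  using assms
proof (induction w rule: induct_list012)
  case (3 a b w)
  show ?case
  proof (cases "a = b")
    case True
    then show ?thesis using block_aligned_after_double 3(3,4) by simp
  next
    case False
    have "block_aligned (b # w) \<or> block_aligned w"
      using 3 by (auto dest: overlap_free_ConsD simp: sublist_Cons_right)
    then show ?thesis using False by auto
  qed
qed simp_all

lemma extendable_thue_morse_cases:
  fixes w :: "bool list"
  assumes "overlap_free (c # w)" and "overlap_free (w @ [d])" and "even (length w)"
  shows "w \<in> range thue_morse \<or> (\<exists>a b. a # w @ [b] \<in> range thue_morse)"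
proof -
  have "\<not> sublist [a, a, \<not> a, a, a] w" for a
  proof
    assume "sublist [a, a, \<not> a, a, a] w"
    then obtain p q where w: "w = p @ [a, a, \<not> a, a, a] @ q" unfolding sublist_def by blast
    then have "p = []" "q = []"
      using overlap_free_aabaa_at_end[of "c # p" a q] overlap_free_aabaa_at_end[of p a "q @ [d]"]
        assms(1,2) by simp_all
    then show False using assms(3) w by simp
  qed
  then consider "block_aligned w" | "block_aligned (tl w)" "w \<noteq> []"
    using overlap_free_block_aligned overlap_free_ConsD[OF assms(1)] by fastforce
  then show ?thesis
  proof cases
    case 1
    then show ?thesis using block_aligned_completion[of w] assms(3) by auto
  next
    case 2
    then have "block_aligned ((\<not> hd w) # w)" by (cases w) auto
    then obtain v where "((\<not> hd w) # w) @ v \<in> range thue_morse" "length v = Suc (length w) mod 2"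
      using block_aligned_completion by fastforce
    moreover from this(2) obtain b where "v = [b]"
      using assms(3) by (auto simp: length_Suc_conv mod_Suc)
    ultimately show ?thesis by auto
  qed
qed

lemma thue_morse_concat_squares:
  assumes "concat Ss = thue_morse w" and "\<forall>S \<in> set Ss. is_square S"
  shows "\<exists>Ts. Ss = map thue_morse Ts \<and> w = concat Ts \<and> (\<forall>T \<in> set Ts. is_square T)"
  using assms
proof (induction Ss arbitrary: w)
  case Nil
  then have "w = []" by (cases w) auto
  then show ?case by (intro exI[of _ "[]"]) simp
next
  case (Cons S Ss)
  obtain x where x: "x \<noteq> []" "S = x @ x" using Cons.prems(2) by (auto simp: is_square_def)
  have "thue_morse w = S @ concat Ss" "even (length S)" using Cons.prems(1) x by simp_all
  then obtain u v where w: "w = u @ v" "thue_morse u = S" "thue_morse v = concat Ss"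
    by (rule thue_morse_eq_appendE)
  obtain y where "x = thue_morse y" "u = y @ y"
    using thue_morse_eq_squareE w(2) x(2) by blast
  moreover from this have "y \<noteq> []" using x(1) by auto
  ultimately have "is_square u" unfolding is_square_def by blast
  moreover obtain Ts where "Ss = map thue_morse Ts" "v = concat Ts" "\<forall>T \<in> set Ts. is_square T"
    using Cons w(3) by force
  ultimately show ?case using w by (intro exI[of _ "u # Ts"]) simp
qed

lemma thue_morse_block:
  assumes "thue_morse w = p @ a # b # q" and "even (length p)"
  shows "b = (\<not> a)"
proof -
  obtain v where "thue_morse v = a # b # q"
    using thue_morse_eq_appendE[OF assms] by blast
  then show ?thesis by (cases v) auto
qed

lemma thue_morse_straddling_even_square:
  assumes "thue_morse w = a # x @ x @ [b]" and "even (length x)" and "x \<noteq> []"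
  shows "a = last x" and "b = hd x"
proof -
  obtain g y where "x = g # y" using assms(3) by (cases x) auto
  moreover from this obtain z l where "y = z @ [l]"
    using assms(2) by (cases y rule: rev_cases) auto
  ultimately have x: "x = g # z @ [l]" by simp
  have "g = (\<not> a)"
    using thue_morse_block[of w "[]"] assms(1) x by simp
  moreover have "g = (\<not> l)"
    using thue_morse_block[of w "a # g # z" l g] assms(1,2) x by simp
  moreover have "b = (\<not> l)"
    using thue_morse_block[of w "a # g # z @ l # g # z" l b "[]"] assms(1,2) x by simp
  ultimately show "a = last x" "b = hd x" using x by auto
qed

definition odd_squares :: "bool list list" where
  "odd_squares = [[False, False], [True, True],
    [False, True, False, False, True, False], [True, False, True, True, False, True]]"

lemma thue_morse_straddling_odd_square:
  assumes "thue_morse w = a # x @ x @ [b]" and "odd (length x)" and "overlap_free x"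
  shows "x @ x \<in> set odd_squares"
proof -
  have "thue_morse w = (a # x) @ (x @ [b])" "even (length (a # x))" using assms by simp_all
  then obtain u v where u: "thue_morse u = a # x" and v: "thue_morse v = x @ [b]"
    by (rule thue_morse_eq_appendE)
  from u obtain y where x: "x = (\<not> a) # thue_morse y" by (cases u) auto
  consider "y = []" | c where "y = [c]" | c d z where "y = c # d # z"
    by (metis list.exhaust)
  then show ?thesis
  proof cases
    case 1
    then show ?thesis by (cases a) (simp_all add: odd_squares_def x)
  next
    case (2 c)
    then have "c = a" using thue_morse_block[of v "[]"] v x by simp
    then show ?thesis using 2 by (cases a) (simp_all add: odd_squares_def x)
  next
    case (3 c d z)
    then have "c = a" using thue_morse_block[of v "[]"] v x by simp
    moreover from this 3 have "d = a"
      using thue_morse_block[of v "[\<not> a, a]" "\<not> a" d] v x by simp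
    ultimately have "x = [] @ (\<not> a) # [a] @ (\<not> a) # [a] @ (\<not> a) # thue_morse z"
      using 3 x by simp
    then show ?thesis using assms(3) not_overlap_free_overlap by metis
  qed
qed

lemma thue_morse_straddling_factor:
  assumes "a # (p @ s @ q) @ [b] \<in> range thue_morse" and "even (length p)" and "even (length s)"
  shows "last (a # p) # s @ [hd (q @ [b])] \<in> range thue_morse"
proof -
  obtain p' c where p: "a # p = p' @ [c]" by (metis list.distinct(1) rev_exhaust)
  obtain d q' where q: "q @ [b] = d # q'" by (cases "q @ [b]") auto
  have "a # (p @ s @ q) @ [b] = (a # p) @ s @ (q @ [b])" by simp
  then have "a # (p @ s @ q) @ [b] = p' @ (c # s @ [d]) @ q'" unfolding p q by simp
  then obtain w where w: "thue_morse w = p' @ (c # s @ [d]) @ q'" using assms(1) by auto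
  have "even (length p')" using arg_cong[OF p, of length] assms(2) by simp
  then obtain v where v: "thue_morse v = (c # s @ [d]) @ q'"
    using thue_morse_eq_appendE[OF w] by blast
  have "even (length (c # s @ [d]))" using assms(3) by simp
  then obtain u where "thue_morse u = c # s @ [d]"
    using thue_morse_eq_appendE[OF v] by blast
  then show ?thesis unfolding p q by (metis last_snoc list.sel(1) rangeI)
qed

lemma square_in_odd_squares:
  assumes "a # (p @ x @ x @ q) @ [b] \<in> range thue_morse" and "even (length p)"
    and "x \<noteq> []" and overlap_free: "overlap_free (p @ x @ x @ q)" and proper: "p \<noteq> [] \<or> q \<noteq> []"
  shows "x @ x \<in> set odd_squares"
proof -
  obtain w where w: "thue_morse w = last (a # p) # x @ x @ [hd (q @ [b])]"
    using thue_morse_straddling_factor[of a p "x @ x" q b] assms(1,2) by auto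
  have "odd (length x)"
  proof
    assume "even (length x)"
    \<comment> \<open>Then the square forms an overlap with the letter before it and with the letter after it.\<close>
    then have "last (a # p) = last x" "hd (q @ [b]) = hd x"
      using thue_morse_straddling_even_square[OF w] \<open>x \<noteq> []\<close> by simp_all
    then consider p' where "p = p' @ [last x]" | q' where "q = hd x # q'"
      using proper by (cases p rule: rev_cases; cases q) auto
    then show False
    proof cases
      case (1 p')
      then show False using overlap_free not_overlap_free_last_square[OF \<open>x \<noteq> []\<close>, of p' q] by simp
    next
      case (2 q')
      then show False using overlap_free not_overlap_free_square_hd[OF \<open>x \<noteq> []\<close>, of p q'] by simp
    qed
  qed
  moreover have "overlap_free x" using overlap_free by (blast dest: overlap_free_appendD)
  ultimately show ?thesis using thue_morse_straddling_odd_square[OF w] by blast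
qed

lemma even_length_concat_squares:
  "\<forall>S \<in> set Ss. is_square S \<Longrightarrow> even (length (concat Ss))"
  by (induction Ss) (auto simp: is_square_def)

lemma concat_squares_eq_Nil_iff:
  "\<forall>S \<in> set Ss. is_square S \<Longrightarrow> concat Ss = [] \<longleftrightarrow> Ss = []"
  by (cases Ss) (auto simp: is_square_def)

lemma squares_subset_odd_squares:
  assumes "a # concat Ss @ [b] \<in> range thue_morse" and "overlap_free (concat Ss)"
    and squares: "\<forall>S \<in> set Ss. is_square S" and "2 \<le> length Ss"
  shows "set Ss \<subseteq> set odd_squares"
proof
  fix S assume "S \<in> set Ss"
  then obtain Us Vs where Ss: "Ss = Us @ S # Vs" by (blast dest: split_list)
  then obtain x where x: "x \<noteq> []" "S = x @ x" using squares by (auto simp: is_square_def)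
  have "Us \<noteq> [] \<or> Vs \<noteq> []" using assms(4) Ss by auto
  then have "concat Us \<noteq> [] \<or> concat Vs \<noteq> []"
    using concat_squares_eq_Nil_iff[of Us] concat_squares_eq_Nil_iff[of Vs] squares Ss by simp
  moreover have "even (length (concat Us))"
    using even_length_concat_squares[of Us] squares Ss by simp
  ultimately show "S \<in> set odd_squares"
    using square_in_odd_squares[of a "concat Us" x "concat Vs" b] assms(1,2) Ss x by simp
qed

fun overlap_free_products :: "'a list list \<Rightarrow> 'a list list \<Rightarrow> nat \<Rightarrow> 'a list list" where
  "overlap_free_products Xs us 0 = us"
| "overlap_free_products Xs us (Suc k) =
    overlap_free_products Xs (filter overlap_free [u @ X. u \<leftarrow> us, X \<leftarrow> Xs]) k"

lemma overlap_free_products_complete: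
  assumes "overlap_free (u @ concat Ss)" and "u \<in> set us" and "set Ss \<subseteq> set Xs"
  shows "u @ concat Ss \<in> set (overlap_free_products Xs us (length Ss))"
  using assms
proof (induction Ss arbitrary: u us)
  case (Cons S Ss)
  let ?vs = "filter overlap_free [u @ X. u \<leftarrow> us, X \<leftarrow> Xs]"
  have "overlap_free ((u @ S) @ concat Ss)" using Cons.prems(1) by simp
  moreover from this have "overlap_free (u @ S)" by (rule overlap_free_appendD)
  then have "u @ S \<in> set ?vs" using Cons.prems(2,3) by auto
  ultimately show ?case using Cons.IH[of "u @ S" ?vs] Cons.prems(3) by simp
qed simp

lemma overlap_free_products_odd_squares:
  "overlap_free_products odd_squares [[False], [True]] 8 = []"
  by code_simp

lemma length_odd_square_factors_le:
  assumes "overlap_free (c # concat Ss)" and "set Ss \<subseteq> set odd_squares"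
  shows "length Ss \<le> 7"
proof (rule ccontr)
  assume "\<not> length Ss \<le> 7"
  then have len: "length (take 8 Ss) = 8" by simp
  have "c # concat Ss = ([c] @ concat (take 8 Ss)) @ concat (drop 8 Ss)"
    by (simp flip: concat_append)
  then have "overlap_free ([c] @ concat (take 8 Ss))"
    using assms(1) overlap_free_appendD(1) by metis
  moreover have "set (take 8 Ss) \<subseteq> set odd_squares"
    using assms(2) set_take_subset[of 8 Ss] by blast
  ultimately have
    "[c] @ concat (take 8 Ss) \<in> set (overlap_free_products odd_squares [[False], [True]] 8)"
    using overlap_free_products_complete[of "[c]" "take 8 Ss" "[[False], [True]]"] len by simp
  then show False by (simp add: overlap_free_products_odd_squares)
qed

lemma length_extendable_square_factors_le:
  fixes Ss :: "bool list list"
  assumes "overlap_free (c # concat Ss)" and "overlap_free (concat Ss @ [d])"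
    and "\<forall>S \<in> set Ss. is_square S"
  shows "length Ss \<le> 7"
  using assms
proof (induction "length (concat Ss)" arbitrary: c d Ss rule: less_induct)
  case less
  consider "length Ss < 2" | w where "concat Ss = thue_morse w" "Ss \<noteq> []"
    | a b where "a # concat Ss @ [b] \<in> range thue_morse" "2 \<le> length Ss"
    using extendable_thue_morse_cases[OF less.prems(1,2)]
      even_length_concat_squares[OF less.prems(3)] by fastforce
  then show ?case
  proof cases
    case (2 w)
    then obtain Ts where Ts: "Ss = map thue_morse Ts" "w = concat Ts" "\<forall>T \<in> set Ts. is_square T"
      using thue_morse_concat_squares less.prems(3) by blast
    have "w \<noteq> []" using 2 concat_squares_eq_Nil_iff[OF less.prems(3)] by auto
    then have "length (concat Ts) < length (concat Ss)" by (simp add: 2(1) flip: Ts(2))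
    moreover have "overlap_free ((\<not> c) # concat Ts)"
      using overlap_free_thue_morseD[of "(\<not> c) # w"] less.prems(1) 2(1) Ts(2) by simp
    moreover have "overlap_free (concat Ts @ [d])"
      using overlap_free_thue_morseD[of "w @ [d]"] less.prems(2) 2(1) Ts(2)
      by (simp add: butlast_append)
    ultimately have "length Ts \<le> 7" using less.hyps Ts(3) by blast
    then show ?thesis using Ts(1) by simp
  next
    case (3 a b)
    then have "set Ss \<subseteq> set odd_squares"
      using squares_subset_odd_squares less.prems(3) overlap_free_ConsD[OF less.prems(1)] by blast
    then show ?thesis using length_odd_square_factors_le less.prems(1) by blast
  qed simp
qed

lemma left_extendable_suffix:
  assumes "overlap_free (concat Ss)" and "[] \<notin> set Ss"
  obtains Ts c where "suffix Ts Ss" "overlap_free (c # concat Ts)"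
    "length Ss + left_ext (concat Ss) \<le> length Ts + 1"
proof (cases "\<exists>c. overlap_free (c # concat Ss)")
  case True
  then show thesis using that[of Ss] by (auto simp: left_ext_def)
next
  case False
  then obtain S Ts where Ss: "Ss = S # Ts"
    by (cases Ss) (auto simp: overlap_free_Cons overlap_free_Nil)
  then have "S = butlast S @ [last S]" using assms(2) by auto
  then have "concat Ss = butlast S @ last S # concat Ts"
    using Ss by (metis append_Cons append_Nil append_assoc concat.simps(2))
  then have "overlap_free (last S # concat Ts)"
    using assms(1) overlap_free_appendD(2) by metis
  then show thesis using that[of Ts] False Ss by (auto simp: left_ext_def suffix_ConsI)
qed

lemma left_ext_rev: "left_ext (rev w) = right_ext w"
proof -
  have "overlap_free ([a] @ rev w) \<longleftrightarrow> overlap_free (w @ [a])" for a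
    using overlap_free_rev[of "w @ [a]"] by simp
  then show ?thesis by (simp add: left_ext_def right_ext_def)
qed

lemma right_extendable_prefix:
  assumes "overlap_free (concat Ss)" and "[] \<notin> set Ss"
  obtains Ts d where "prefix Ts Ss" "overlap_free (concat Ts @ [d])"
    "length Ss + right_ext (concat Ss) \<le> length Ts + 1"
proof -
  let ?Rs = "rev (map rev Ss)"
  have concat_Rs: "concat ?Rs = rev (concat Ss)" by (simp add: rev_concat rev_map)
  have "overlap_free (concat ?Rs)" "[] \<notin> set ?Rs"
    using assms by (auto simp: concat_Rs overlap_free_rev)
  then obtain Ts d where Ts: "suffix Ts ?Rs" "overlap_free (d # concat Ts)"
    "length ?Rs + left_ext (concat ?Rs) \<le> length Ts + 1"
    by (rule left_extendable_suffix)
  let ?Us = "map rev (rev Ts)"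
  have "prefix (rev Ts) (map rev Ss)"
    using Ts(1) by (simp add: suffix_to_prefix)
  then have "prefix ?Us Ss"
    using map_mono_prefix[of "rev Ts" "map rev Ss" rev] by (simp add: map_idI)
  moreover have "concat ?Us @ [d] = rev (d # concat Ts)"
    by (simp add: rev_concat)
  then have "overlap_free (concat ?Us @ [d])"
    using Ts(2) overlap_free_rev by metis
  moreover have "length Ss + right_ext (concat Ss) \<le> length ?Us + 1"
    using Ts(3) concat_Rs by (simp add: left_ext_rev)
  ultimately show thesis using that by blast
qed

lemma right_ext_append_le: "right_ext (u @ v) \<le> right_ext v"
  using overlap_free_appendD(2)[of u] by (auto simp: right_ext_def)

theorem theorem8:
  fixes w :: "bool list" and Ss :: "bool list list"
  assumes "overlap_free w"
    and "w = concat Ss"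
    and "\<forall>S \<in> set Ss. is_square S"
  shows "length Ss + left_ext w + right_ext w \<le> 9"
proof -
  have nonempty: "[] \<notin> set Ss" using assms(3) by (auto simp: is_square_def)
  then obtain Ts c where "suffix Ts Ss" and c: "overlap_free (c # concat Ts)"
    and left: "length Ss + left_ext w \<le> length Ts + 1"
    using left_extendable_suffix[of Ss] assms(1,2) by metis
  then obtain Us where Ss: "Ss = Us @ Ts" by (auto simp: suffix_def)
  obtain Vs d where "prefix Vs Ts" and d: "overlap_free (concat Vs @ [d])"
    and right: "length Ts + right_ext (concat Ts) \<le> length Vs + 1"
    using right_extendable_prefix[of Ts] overlap_free_ConsD[OF c] nonempty Ss by auto
  then obtain Ws where Ts: "Ts = Vs @ Ws" by (auto simp: prefix_def)
  have "overlap_free (c # concat Vs)"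
    using c overlap_free_appendD(1)[of "c # concat Vs" "concat Ws"] Ts by simp
  then have "length Vs \<le> 7"
    using length_extendable_square_factors_le[OF _ d] assms(3) Ss Ts by simp
  moreover have "right_ext w \<le> right_ext (concat Ts)"
    using right_ext_append_le assms(2) Ss by simp
  ultimately show ?thesis using left right by linarith
qed

end
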